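(* Let $m > k > 0$ be positive integers, let $n$ be a positive integer, and let $A$ and $B$ be $n\times n$ Hermitian matrices of norm $1$ such that the pair $(A,B)$ minimizes (resp. maximizes) the quantity $\mathrm{Tr}[S_{m,k}(X,Y)]$ over all pairs $(X,Y)$ of $n\times n$ Hermitian matrices of norm $1$. Then $A$ and $B$ satisfy the following pair of equations: $$A\,S_{m-1,k}(A,B) = \mathrm{Tr}[A\,S_{m-1,k}(A,B)]\; A^2,$$ $$B\,S_{m-1,k-1}(A,B) = \mathrm{Tr}[B\,S_{m-1,k-1}(A,B)]\; B^2.$$
   Context: Matrices are complex. For a complex matrix $C$, $C^*$ denotes the conjugate transpose, and the norm is $\|C\| = \mathrm{Tr}[CC^*]^{1/2}$. For $n\times n$ matrices $A,B$ and integers $m\ge 0$, $0\le k\le m$, $S_{m,k}(A,B)$ denotes the sum of all words of length $m$ in $A$ and $B$ in which exactly $k$ $B$'s appear, i.e. the (matrix) coefficient of $t^k$ in $(A+tB)^m$ (so $S_{0,0}(A,B)=I$). When $A,B$ are Hermitian, $\mathrm{Tr}[S_{m,k}(A,B)]$ is real. *)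

theory Defs
  imports "HOL-Analysis.Analysis"
begin

text \<open>
  Matrices have type \<^typ>\<open>complex^'n^'n\<close>.  The operators \<open>*\<close> and \<open>^\<close> are componentwise on this
  type, so they are not used; \<open>**\<close> is the matrix product and \<^term>\<open>mat 1\<close> the identity.
\<close>

definition ctranspose :: "complex^'n^'n \<Rightarrow> complex^'n^'n" where
  "ctranspose C = (\<chi> i j. cnj (C $ j $ i))"

definition hermitian :: "complex^'n^'n \<Rightarrow> bool" where
  "hermitian C \<longleftrightarrow> ctranspose C = C"

text \<open>The trace of \<open>C C\<^sup>*\<close> is a nonnegative real (see \<open>trace_mult_ctranspose\<close>), so \<^const>\<open>Re\<close>
  loses nothing.\<close>

definition frob_norm :: "complex^'n^'n \<Rightarrow> real" where
  "frob_norm C = sqrt (Re (trace (C ** ctranspose C)))"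

definition mat_scale :: "complex \<Rightarrow> complex^'n^'n \<Rightarrow> complex^'n^'n" where
  "mat_scale c C = (\<chi> i j. c * C $ i $ j)"

text \<open>A word in two letters is a \<^typ>\<open>bool list\<close>, where \<^const>\<open>False\<close> stands for \<open>A\<close> and
  \<^const>\<open>True\<close> for \<open>B\<close>.\<close>

definition word_prod :: "complex^'n^'n \<Rightarrow> complex^'n^'n \<Rightarrow> bool list \<Rightarrow> complex^'n^'n" where
  "word_prod A B w = foldr (\<lambda>b C. (if b then B else A) ** C) w (mat 1)"

definition words :: "nat \<Rightarrow> nat \<Rightarrow> bool list set" where
  "words m k = {w. length w = m \<and> count_list w True = k}"

definition S :: "nat \<Rightarrow> nat \<Rightarrow> complex^'n^'n \<Rightarrow> complex^'n^'n \<Rightarrow> complex^'n^'n" where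
  "S m k A B = (\<Sum>w\<in>words m k. word_prod A B w)"

lemma trace_mult_ctranspose:
  "trace (C ** ctranspose C) = of_real (\<Sum>i\<in>UNIV. \<Sum>j\<in>UNIV. (cmod (C $ i $ j))\<^sup>2)"
  by (simp add: trace_def matrix_matrix_mult_def ctranspose_def complex_norm_square[symmetric])

lemma finite_words: "finite (words m k)"
proof (rule finite_subset)
  show "words m k \<subseteq> {w. set w \<subseteq> UNIV \<and> length w = m}"
    by (auto simp: words_def)
qed (rule finite_lists_length_eq, simp)

lemma word_prod_Nil: "word_prod A B [] = mat 1"
  by (simp add: word_prod_def)

lemma word_prod_Cons: "word_prod A B (b # w) = (if b then B else A) ** word_prod A B w"
  by (simp add: word_prod_def)

lemma sum_matrix_mult_left: "C ** (\<Sum>x\<in>X. f x) = (\<Sum>x\<in>X. C ** f x)"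
  for C :: "complex^'n^'n"
  by (induction X rule: infinite_finite_induct) (simp_all add: matrix_add_ldistrib)

lemma words_0: "words 0 k = (if k = 0 then {[]} else {})"
  by (auto simp: words_def)

lemma words_Suc_0: "words (Suc m) 0 = (#) False ` words m 0"
  by (auto simp: words_def length_Suc_conv image_iff split: if_splits)

lemma words_Suc_Suc:
  "words (Suc m) (Suc k) = (#) False ` words m (Suc k) \<union> (#) True ` words m k"
  by (auto simp: words_def length_Suc_conv image_iff split: if_splits)

lemma S_0: "S 0 k A B = (if k = 0 then mat 1 else 0)"
  by (simp add: S_def words_0 word_prod_Nil)

lemma S_Suc_0: "S (Suc m) 0 A B = A ** S m 0 A B"
  by (simp add: S_def words_Suc_0 sum.reindex word_prod_Cons sum_matrix_mult_left)

lemma S_Suc_Suc: "S (Suc m) (Suc k) A B = A ** S m (Suc k) A B + B ** S m k A B"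
proof -
  have "S (Suc m) (Suc k) A B = (\<Sum>w\<in>(#) False ` words m (Suc k). word_prod A B w)
      + (\<Sum>w\<in>(#) True ` words m k. word_prod A B w)"
    unfolding S_def words_Suc_Suc by (rule sum.union_disjoint) (auto simp: finite_words)
  then show ?thesis
    by (simp add: S_def sum.reindex word_prod_Cons sum_matrix_mult_left)
qed

lemma S_eq_0: "m < k \<Longrightarrow> S m k A B = 0"
  by (induction m arbitrary: k; case_tac k)
    (simp_all add: S_0 S_Suc_Suc)

text \<open>\<^const>\<open>S\<close> collects the coefficients of the powers of \<open>t\<close> in \<open>(A + t B)\<^sup>m\<close>.\<close>

lemma mat_scale_simps:
  "mat_scale 1 C = C" "mat_scale 0 C = 0" "mat_scale c 0 = 0"
  "mat_scale c (C + D) = mat_scale c C + mat_scale c D"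
  "mat_scale c (mat_scale d C) = mat_scale (c * d) C"
  "C ** mat_scale c D = mat_scale c (C ** D)"
  "mat_scale c C ** D = mat_scale c (C ** D)"
  by (simp_all add: mat_scale_def vec_eq_iff matrix_matrix_mult_def algebra_simps sum_distrib_left)

lemma matrix_add_mult_right: "(C + D) ** E = C ** E + D ** E"
  for C :: "complex^'n^'n"
  by (simp add: vec_eq_iff matrix_matrix_mult_def algebra_simps sum.distrib)

lemma S_generating:
  "(((**) (A + mat_scale t B)) ^^ m) (mat 1) = (\<Sum>k\<le>m. mat_scale (t ^ k) (S m k A B))"
proof (induction m)
  case 0
  show ?case by (simp add: S_0 mat_scale_simps)
next
  case (Suc m)
  let ?f = "\<lambda>k. mat_scale (t ^ k) (S m k A B)"
  have A: "A ** (\<Sum>k\<le>m. ?f k) = (\<Sum>k\<le>Suc m. mat_scale (t ^ k) (A ** S m k A B))"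
    by (simp add: sum_matrix_mult_left mat_scale_simps S_eq_0)
  have B: "mat_scale t B ** (\<Sum>k\<le>m. ?f k) = (\<Sum>k\<le>m. mat_scale (t ^ Suc k) (B ** S m k A B))"
    by (simp add: sum_matrix_mult_left mat_scale_simps mult.commute)
  have "(\<Sum>k\<le>Suc m. mat_scale (t ^ k) (S (Suc m) k A B))
      = (\<Sum>k\<le>Suc m. mat_scale (t ^ k) (A ** S m k A B))
        + (\<Sum>k\<le>m. mat_scale (t ^ Suc k) (B ** S m k A B))"
    unfolding sum.atMost_Suc_shift
    by (simp add: S_Suc_0 S_Suc_Suc mat_scale_simps sum.distrib add.assoc del: power_Suc)
  also have "\<dots> = (A + mat_scale t B) ** (\<Sum>k\<le>m. ?f k)"
    by (simp only: A B matrix_add_mult_right)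
  finally show ?case by (simp add: Suc)
qed

text \<open>For Hermitian matrices the trace of \<^const>\<open>S\<close> is real, so extremizing it means extremizing
  its real part.\<close>

lemma ctranspose_mult: "ctranspose (C ** D) = ctranspose D ** ctranspose C"
  by (simp add: ctranspose_def vec_eq_iff matrix_matrix_mult_def mult.commute)

lemma word_prod_append: "word_prod A B (v @ w) = word_prod A B v ** word_prod A B w"
  by (induction v) (simp_all add: word_prod_Nil word_prod_Cons matrix_mul_assoc)

lemma ctranspose_word_prod:
  assumes "hermitian A" "hermitian B"
  shows "ctranspose (word_prod A B w) = word_prod A B (rev w)"
proof (induction w)
  case Nil
  show ?case
    by (auto simp: word_prod_Nil ctranspose_def vec_eq_iff mat_def)
next
  case (Cons b w)
  then show ?case
    using assms
    by (auto simp: word_prod_Cons word_prod_append word_prod_Nil ctranspose_mult hermitian_def)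
qed

lemma hermitian_S:
  assumes "hermitian A" "hermitian B"
  shows "hermitian (S m k A B)"
proof -
  have "ctranspose (S m k A B) = (\<Sum>w\<in>words m k. ctranspose (word_prod A B w))"
    by (simp add: S_def ctranspose_def vec_eq_iff)
  also have "\<dots> = (\<Sum>w\<in>words m k. word_prod A B (rev w))"
    by (simp add: ctranspose_word_prod assms)
  also have "\<dots> = S m k A B"
    unfolding S_def
    by (rule sum.reindex_bij_witness[of _ rev rev]) (auto simp: words_def)
  finally show ?thesis by (simp add: hermitian_def)
qed

lemma trace_S_real:
  assumes "hermitian A" "hermitian B"
  shows "trace (S m k A B) \<in> \<real>"
proof -
  have "cnj (trace C) = trace (ctranspose C)" for C :: "complex^'n^'n"
    by (simp add: trace_def ctranspose_def)
  then show ?thesis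
    using hermitian_S[OF assms, of m k] by (metis Reals_cnj_iff hermitian_def)
qed

end

theory Submission
  imports Defs
begin

text \<open>
  The theorem is a Lagrange multiplier condition.  Fix \<open>B\<close> and vary \<open>A\<close> on the unit sphere of the
  real inner product space of Hermitian matrices, where \<open>H \<bullet> C = Tr (H C)\<close>.  Differentiating
  \<open>Tr S\<^sub>m\<^sub>,\<^sub>k (A + s H, B)\<close> at \<open>s = 0\<close> replaces one letter \<open>A\<close> of each word by \<open>H\<close>; by cyclicity of
  the trace \<open>H\<close> may be rotated to the front, and each of the \<open>m\<close> positions of \<open>H\<close> then contributes
  every word of length \<open>m - 1\<close> exactly once.  The derivative is therefore
  \<open>m Tr (H S\<^sub>m\<^sub>-\<^sub>1\<^sub>,\<^sub>k (A, B))\<close> (\<open>Re_trace_S_has_derivative\<close>), so \<open>m S\<^sub>m\<^sub>-\<^sub>1\<^sub>,\<^sub>k (A, B)\<close> is the gradient.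

  At an extremum the gradient is orthogonal to the tangent space of the sphere, which means that
  \<open>S\<^sub>m\<^sub>-\<^sub>1\<^sub>,\<^sub>k (A, B) = c A\<close> for a real \<open>c\<close> (\<open>S_proportional_of_extremal\<close>).  Multiplying by \<open>A\<close> and
  taking traces identifies \<open>c\<close>, because \<open>Tr A\<^sup>2 = 1\<close>.  The second equation is the first one with the
  two letters exchanged, since \<open>S\<^sub>m\<^sub>,\<^sub>k (A, B) = S\<^sub>m\<^sub>,\<^sub>m\<^sub>-\<^sub>k (B, A)\<close> (\<open>S_swap\<close>).
\<close>

section \<open>The Frobenius inner product\<close>

lemma inner_eq_Re_trace: "C \<bullet> D = Re (trace (C ** ctranspose D))"
  for C D :: "complex^'n^'n"
  by (simp add: inner_vec_def trace_def matrix_matrix_mult_def ctranspose_def inner_complex_def)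

text \<open>The library norm on vectors of vectors is the Euclidean norm of all entries, so the calculus of
  real inner product spaces applies to matrices directly.\<close>

lemma frob_norm_eq_norm: "frob_norm C = norm C"
  by (simp add: frob_norm_def norm_eq_sqrt_inner inner_eq_Re_trace)

lemma hermitian_add: "hermitian C \<Longrightarrow> hermitian D \<Longrightarrow> hermitian (C + D)"
  by (simp add: hermitian_def ctranspose_def vec_eq_iff)

lemma hermitian_diff: "hermitian C \<Longrightarrow> hermitian D \<Longrightarrow> hermitian (C - D)"
  by (simp add: hermitian_def ctranspose_def vec_eq_iff)

lemma hermitian_scaleR: "hermitian C \<Longrightarrow> hermitian (r *\<^sub>R C)"
  by (simp add: hermitian_def ctranspose_def vec_eq_iff)

lemma matrix_mult_scaleR_right: "C ** (r *\<^sub>R D) = r *\<^sub>R (C ** D)"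
  for C D :: "complex^'n^'n"
  by (simp add: vec_eq_iff matrix_matrix_mult_def scaleR_sum_right)

lemma matrix_mult_scaleR_left: "(r *\<^sub>R C) ** D = r *\<^sub>R (C ** D)"
  for C D :: "complex^'n^'n"
  by (simp add: vec_eq_iff matrix_matrix_mult_def scaleR_sum_right)

text \<open>Boundedness is automatic in finite dimension; this supplies the product rule.\<close>

lemma bounded_bilinear_matrix_mult:
  "bounded_bilinear ((**) :: complex^'n^'n \<Rightarrow> complex^'n^'n \<Rightarrow> complex^'n^'n)"
  unfolding bilinear_conv_bounded_bilinear[symmetric] bilinear_def
  by (auto intro!: linearI simp: matrix_add_ldistrib matrix_add_mult_right
      matrix_mult_scaleR_right matrix_mult_scaleR_left)

lemma trace_sum: "trace (\<Sum>x\<in>X. f x) = (\<Sum>x\<in>X. trace (f x))"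
  for f :: "'a \<Rightarrow> complex^'n^'n"
  by (induction X rule: infinite_finite_induct) (simp_all add: trace_add, simp_all add: trace_def)

lemma bounded_linear_Re_trace: "bounded_linear (\<lambda>C :: complex^'n^'n. Re (trace C))"
  unfolding linear_conv_bounded_linear[symmetric]
  by (auto intro!: linearI simp: trace_def sum.distrib sum_distrib_left)

section \<open>Homogeneity and symmetry of the word sums\<close>

lemma count_list_False: "count_list w False + count_list w True = length w"
  by (induction w) auto

lemma word_prod_scaleR:
  "word_prod (r *\<^sub>R A) B w = r ^ count_list w False *\<^sub>R word_prod A B w"
  by (induction w)
    (simp_all add: word_prod_Nil word_prod_Cons matrix_mult_scaleR_left matrix_mult_scaleR_right)

lemma S_scaleR: "S m k (r *\<^sub>R A) B = r ^ (m - k) *\<^sub>R S m k A B"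
proof -
  have "word_prod (r *\<^sub>R A) B w = r ^ (m - k) *\<^sub>R word_prod A B w" if "w \<in> words m k" for w
  proof -
    have "count_list w False = m - k"
      using that count_list_False[of w] by (auto simp: words_def)
    then show ?thesis by (simp add: word_prod_scaleR)
  qed
  then show ?thesis by (simp add: S_def scaleR_sum_right)
qed

lemma count_list_map_Not: "count_list (map Not w) True = count_list w False"
  by (induction w) auto

lemma word_prod_map_Not: "word_prod B A (map Not w) = word_prod A B w"
  by (induction w) (simp_all add: word_prod_Nil word_prod_Cons)

lemma S_swap:
  assumes "k \<le> m"
  shows "S m (m - k) B A = S m k A B"
  unfolding S_def
proof (rule sum.reindex_bij_witness[of _ "map Not" "map Not"])
  show "map Not w \<in> words m k" if "w \<in> words m (m - k)" for w
    using that assms count_list_False[of w] by (auto simp: words_def count_list_map_Not)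
  show "map Not w \<in> words m (m - k)" if "w \<in> words m k" for w
    using that assms count_list_False[of w] by (auto simp: words_def count_list_map_Not)
  show "word_prod A B (map Not w) = word_prod B A w" for w
    by (rule word_prod_map_Not)
qed (simp_all add: comp_def)

section \<open>The derivative of the trace\<close>

text \<open>This is the Leibniz rule: the letter \<open>A\<close> at position \<open>i\<close> is replaced by \<open>H\<close>, while the letters
  \<open>B\<close> are constant and contribute nothing.\<close>

lemma word_prod_has_vector_derivative:
  "((\<lambda>s. word_prod (A + s *\<^sub>R H) B w) has_vector_derivative
     (\<Sum>i<length w. if w ! i then 0
        else word_prod A B (take i w) ** H ** word_prod A B (drop (Suc i) w))) (at 0)"
proof (induction w)
  case Nil
  show ?case by (simp add: word_prod_Nil)
next
  case (Cons b w)
  let ?D = "\<lambda>(w :: bool list) i. if w ! i then 0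
        else word_prod A B (take i w) ** H ** word_prod A B (drop (Suc i) w)"
  have letter: "((\<lambda>s. if b then B else A + s *\<^sub>R H) has_vector_derivative (if b then 0 else H)) (at 0)"
    by (auto intro!: derivative_eq_intros)
  have "((\<lambda>s. word_prod (A + s *\<^sub>R H) B (b # w)) has_vector_derivative
      (if b then B else A) ** (\<Sum>i<length w. ?D w i) + (if b then 0 else H) ** word_prod A B w) (at 0)"
    using bounded_bilinear.has_vector_derivative[OF bounded_bilinear_matrix_mult letter Cons]
    by (cases b) (simp_all add: word_prod_Cons)
  also have "(if b then B else A) ** (\<Sum>i<length w. ?D w i) + (if b then 0 else H) ** word_prod A B w
      = (\<Sum>i<length (b # w). ?D (b # w) i)"
    by (auto simp: sum.lessThan_Suc_shift sum_matrix_mult_left word_prod_Nil word_prod_Cons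
        matrix_mul_assoc if_distrib[of "(**) _"] simp del: sum.lessThan_Suc intro!: sum.cong)
  finally show ?case .
qed

text \<open>Deleting the letter \<open>A\<close> at a fixed position \<open>i\<close> and rotating the rest cyclically, so that it
  starts just behind the gap, loses no information: the letter can be put back at distance \<open>i\<close> from
  the end of the rotated word.  So the words with an \<open>A\<close> at position \<open>i\<close> correspond bijectively to
  all words that are one letter shorter and have as many \<open>B\<close>'s.\<close>

lemma sum_words_rotate:
  assumes "i < Suc p"
  shows "(\<Sum>w\<in>words (Suc p) k. if w ! i then 0 else f (drop (Suc i) w @ take i w))
       = (\<Sum>v\<in>words p k. f v)"
proof -
  have "(\<Sum>w\<in>words (Suc p) k. if w ! i then 0 else f (drop (Suc i) w @ take i w))
      = (\<Sum>w\<in>{w\<in>words (Suc p) k. \<not> w ! i}. f (drop (Suc i) w @ take i w))"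
    by (simp add: finite_words sum.inter_filter if_not_P cong: if_cong) (rule sum.cong; simp)
  also have "\<dots> = (\<Sum>v\<in>words p k. f v)"
  proof (rule sum.reindex_bij_witness[of _
        "\<lambda>v. drop (p - i) v @ False # take (p - i) v" "\<lambda>w. drop (Suc i) w @ take i w"])
    fix w assume w: "w \<in> {w\<in>words (Suc p) k. \<not> w ! i}"
    then have len: "length w = Suc p" and "\<not> w ! i" and cnt: "count_list w True = k"
      by (auto simp: words_def)
    have split: "w = take i w @ False # drop (Suc i) w"
      using id_take_nth_drop[of i w] len assms \<open>\<not> w ! i\<close> by simp
    show "drop (p - i) (drop (Suc i) w @ take i w) @
        False # take (p - i) (drop (Suc i) w @ take i w) = w"
      using split len assms by simp
    have "count_list w True = count_list (take i w) True + count_list (drop (Suc i) w) True"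
      by (subst split) simp
    then show "drop (Suc i) w @ take i w \<in> words p k"
      using cnt len assms by (simp add: words_def)
  next
    fix v assume "v \<in> words p k"
    then have len: "length v = p" and cnt: "count_list v True = k"
      by (auto simp: words_def)
    have "count_list v True = count_list (take (p - i) v) True + count_list (drop (p - i) v) True"
      by (metis append_take_drop_id count_list_append)
    then show "drop (p - i) v @ False # take (p - i) v \<in> {w\<in>words (Suc p) k. \<not> w ! i}"
      using len cnt assms by (simp add: words_def nth_append)
    show "drop (Suc i) (drop (p - i) v @ False # take (p - i) v) @
        take i (drop (p - i) v @ False # take (p - i) v) = v"
      using len assms by simp
  qed simp
  finally show ?thesis .
qed

text \<open>The number of positions, not the number \<open>Suc p - k\<close> of letters \<open>A\<close> in a word, is the factor:
  for each position the words with an \<open>A\<close> there already exhaust \<open>S p k A B\<close>.\<close>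

lemma Re_trace_S_has_derivative:
  "((\<lambda>s. Re (trace (S (Suc p) k (A + s *\<^sub>R H) B))) has_real_derivative
     real (Suc p) * Re (trace (H ** S p k A B))) (at 0)"
  for A B H :: "complex^'n^'n"
proof -
  let ?D = "\<lambda>(w :: bool list) i. if w ! i then 0
        else word_prod A B (take i w) ** H ** word_prod A B (drop (Suc i) w)"
  have "((\<lambda>s. S (Suc p) k (A + s *\<^sub>R H) B) has_vector_derivative
      (\<Sum>w\<in>words (Suc p) k. \<Sum>i<length w. ?D w i)) (at 0)"
    unfolding S_def by (intro has_vector_derivative_sum word_prod_has_vector_derivative)
  then have "((\<lambda>s. Re (trace (S (Suc p) k (A + s *\<^sub>R H) B))) has_real_derivative
      Re (trace (\<Sum>w\<in>words (Suc p) k. \<Sum>i<length w. ?D w i))) (at 0)"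
    unfolding has_real_derivative_iff_has_vector_derivative
    by (rule bounded_linear.has_vector_derivative[OF bounded_linear_Re_trace])
  also have "trace (\<Sum>w\<in>words (Suc p) k. \<Sum>i<length w. ?D w i)
      = (\<Sum>w\<in>words (Suc p) k. \<Sum>i<Suc p. trace (?D w i))"
    unfolding trace_sum by (intro sum.cong) (auto simp: words_def)
  also have "\<dots> = (\<Sum>i<Suc p. \<Sum>w\<in>words (Suc p) k. trace (?D w i))"
    by (rule sum.swap)
  also have "\<dots> = (\<Sum>i<Suc p. \<Sum>w\<in>words (Suc p) k. if w ! i then 0
        else trace (H ** word_prod A B (drop (Suc i) w @ take i w)))"
  proof (intro sum.cong refl)
    fix w i
    have "trace (U ** H ** V) = trace (H ** (V ** U))" for U V :: "complex^'n^'n"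
      by (metis matrix_mul_assoc trace_mul_sym)
    then show "trace (?D w i) = (if w ! i then 0
        else trace (H ** word_prod A B (drop (Suc i) w @ take i w)))"
      by (simp add: word_prod_append) (simp add: trace_def)
  qed
  also have "\<dots> = (\<Sum>i<Suc p. \<Sum>v\<in>words p k. trace (H ** word_prod A B v))"
    by (intro sum.cong refl sum_words_rotate) simp
  also have "\<dots> = of_nat (Suc p) * trace (H ** S p k A B)"
    by (simp add: S_def sum_matrix_mult_left trace_sum)
  finally show ?thesis by simp
qed

section \<open>The critical point equation\<close>

text \<open>A tangent direction changes the norm only to second order, so renormalizing \<open>A + s H\<close> does not
  affect first derivatives at \<open>0\<close>.\<close>

lemma norm_perturbation_has_derivative_0:
  assumes "norm A = 1" "A \<bullet> H = 0"
  shows "((\<lambda>s. norm (A + s *\<^sub>R H)) has_real_derivative 0) (at 0)"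
proof -
  have "norm (A + s *\<^sub>R H) = sqrt (1 + s\<^sup>2 * (norm H)\<^sup>2)" for s
    using assms by (simp add: norm_eq_sqrt_inner inner_add_left inner_add_right inner_commute
        power2_eq_square)
  moreover have "((\<lambda>s. sqrt (1 + s\<^sup>2 * (norm H)\<^sup>2)) has_real_derivative 0) (at 0)"
    by (auto intro!: derivative_eq_intros)
  ultimately show ?thesis by simp
qed

text \<open>The sign of \<open>\<sigma>\<close> treats minima and maxima at once.  The test direction is the component \<open>H\<close> of
  \<open>S (m - 1) k A B\<close> orthogonal to \<open>A\<close>: the derivative along it is a nonzero multiple of
  \<open>H \<bullet> H\<close>, so it can vanish only if \<open>H = 0\<close>.\<close>

lemma S_proportional_of_extremal:
  fixes A B :: "complex^'n^'n" and \<sigma> :: real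
  assumes "k < m" "hermitian A" "hermitian B" "norm A = 1" "\<sigma> \<noteq> 0"
    and ext: "\<And>X. hermitian X \<Longrightarrow> norm X = 1 \<Longrightarrow>
      \<sigma> * Re (trace (S m k A B)) \<le> \<sigma> * Re (trace (S m k X B))"
  obtains c :: real where "S (m - 1) k A B = c *\<^sub>R A"
proof -
  obtain p where m: "m = Suc p" using \<open>k < m\<close> by (cases m) auto
  define T where "T = S p k A B"
  define H where "H = T - (A \<bullet> T) *\<^sub>R A"
  have hT: "hermitian T" unfolding T_def by (rule hermitian_S) fact+
  have hH: "hermitian H" unfolding H_def by (intro hermitian_diff hermitian_scaleR hT assms)
  have AA: "A \<bullet> A = 1" using \<open>norm A = 1\<close> by (simp add: dot_square_norm)
  have orth: "A \<bullet> H = 0" by (simp add: H_def inner_diff_right AA)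
  define F where "F s = Re (trace (S m k (A + s *\<^sub>R H) B))" for s
  \<comment> \<open>By homogeneity of degree \<open>m - k\<close>, extremality on the unit sphere becomes the inequality
    \<open>G \<ge> 0\<close> on the whole line \<open>A + s H\<close>, with equality at \<open>s = 0\<close>.\<close>
  define G where "G s = \<sigma> * F s - \<sigma> * F 0 * norm (A + s *\<^sub>R H) ^ (m - k)" for s
  have "Re (trace (H ** T)) = H \<bullet> T"
    using hT by (simp add: inner_eq_Re_trace hermitian_def)
  then have F': "(F has_real_derivative real m * (H \<bullet> T)) (at 0)"
    using Re_trace_S_has_derivative[of p k A H B] by (simp add: F_def[abs_def] T_def m)
  have G': "(G has_real_derivative \<sigma> * (real m * (H \<bullet> T))) (at 0)"
    unfolding G_def[abs_def]
    by (rule derivative_eq_intros F' norm_perturbation_has_derivative_0[OF \<open>norm A = 1\<close> orth] refl)+ simp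
  have "G 0 \<le> G s" for s
  proof -
    define r where "r = norm (A + s *\<^sub>R H)"
    have "r\<^sup>2 = 1 + s\<^sup>2 * (H \<bullet> H)"
      unfolding r_def power2_norm_eq_inner using orth
      by (simp add: inner_add_left inner_add_right inner_commute AA power2_eq_square)
    then have "r \<noteq> 0"
      by (smt (verit) inner_ge_zero mult_nonneg_nonneg zero_le_power2 zero_power2)
    then have "r > 0" by (simp add: r_def)
    define X where "X = (1 / r) *\<^sub>R (A + s *\<^sub>R H)"
    have X: "hermitian X" "norm X = 1"
      using \<open>r > 0\<close> by (auto simp: X_def r_def[symmetric] intro!: hermitian_scaleR hermitian_add hH assms)
    have "A + s *\<^sub>R H = r *\<^sub>R X"
      using \<open>r > 0\<close> by (simp add: X_def)
    then have "F s = r ^ (m - k) * Re (trace (S m k X B))"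
      by (simp add: F_def S_scaleR trace_def sum_distrib_left)
    moreover have "\<sigma> * F 0 * r ^ (m - k) \<le> \<sigma> * Re (trace (S m k X B)) * r ^ (m - k)"
      using ext[OF X] \<open>r > 0\<close> by (intro mult_right_mono) (simp_all add: F_def)
    ultimately have "0 \<le> G s" by (simp add: G_def r_def mult_ac)
    moreover have "G 0 = 0" using \<open>norm A = 1\<close> by (simp add: G_def)
    ultimately show ?thesis by simp
  qed
  then have "\<sigma> * (real m * (H \<bullet> T)) = 0"
    using DERIV_local_min[OF G', of 1] by simp
  then have "H \<bullet> T = 0" using \<open>\<sigma> \<noteq> 0\<close> m by simp
  moreover have "H \<bullet> T = H \<bullet> H"
    using orth by (simp add: H_def inner_diff_right inner_commute)
  ultimately have "H = 0" by simp
  then have "T = (A \<bullet> T) *\<^sub>R A" by (simp add: H_def)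
  then show ?thesis using that m by (simp add: T_def)
qed

text \<open>A Hermitian \<open>A\<close> of norm \<open>1\<close> has \<open>trace (A ** A) = 1\<close>, so the factor of proportionality is
  itself a trace.\<close>

lemma mult_eq_trace_scale_square:
  fixes A T :: "complex^'n^'n"
  assumes "hermitian A" "frob_norm A = 1" "T = c *\<^sub>R A"
  shows "A ** T = mat_scale (trace (A ** T)) (A ** A)"
proof -
  have "trace (A ** A) = of_real (Re (trace (A ** A)))"
    using trace_mult_ctranspose[of A] \<open>hermitian A\<close> by (simp add: hermitian_def)
  also have "Re (trace (A ** A)) = 1"
    using assms(1,2) by (simp add: frob_norm_def hermitian_def)
  finally have "trace (A ** A) = 1" by simp
  moreover have T: "A ** T = mat_scale (of_real c) (A ** A)"
    unfolding assms(3) matrix_mult_scaleR_right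
    by (simp add: mat_scale_def vec_eq_iff scaleR_conv_of_real[where 'a=complex])
  ultimately have "trace (A ** T) = of_real c"
    by (simp add: trace_def mat_scale_def flip: sum_distrib_left)
  then show ?thesis using T by simp
qed

theorem corollary3p7:
  fixes A B :: "complex^'n^'n" and m k :: nat
  assumes "0 < k" and "k < m"
    and "hermitian A" and "hermitian B"
    and "frob_norm A = 1" and "frob_norm B = 1"
    and extremal:
      "(\<forall>X Y :: complex^'n^'n. hermitian X \<and> hermitian Y \<and> frob_norm X = 1 \<and> frob_norm Y = 1 \<longrightarrow>
          Re (trace (S m k A B)) \<le> Re (trace (S m k X Y))) \<or>
       (\<forall>X Y :: complex^'n^'n. hermitian X \<and> hermitian Y \<and> frob_norm X = 1 \<and> frob_norm Y = 1 \<longrightarrow>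
          Re (trace (S m k X Y)) \<le> Re (trace (S m k A B)))"
  shows "A ** S (m - 1) k A B = mat_scale (trace (A ** S (m - 1) k A B)) (A ** A) \<and>
         B ** S (m - 1) (k - 1) A B = mat_scale (trace (B ** S (m - 1) (k - 1) A B)) (B ** B)"
proof -
  obtain \<sigma> :: real where "\<sigma> \<noteq> 0"
    and ext: "\<And>X Y :: complex^'n^'n. hermitian X \<Longrightarrow> hermitian Y \<Longrightarrow> norm X = 1 \<Longrightarrow> norm Y = 1 \<Longrightarrow>
      \<sigma> * Re (trace (S m k A B)) \<le> \<sigma> * Re (trace (S m k X Y))"
    using extremal
  proof (elim disjE, goal_cases)
    case 1
    show ?case by (rule 1(1)[of 1]) (use 1(2) in \<open>auto simp: frob_norm_eq_norm\<close>)
  next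
    case 2
    show ?case by (rule 2(1)[of "-1"]) (use 2(2) in \<open>auto simp: frob_norm_eq_norm\<close>)
  qed
  have norms: "norm A = 1" "norm B = 1"
    using assms by (simp_all add: frob_norm_eq_norm)
  obtain a where a: "S (m - 1) k A B = a *\<^sub>R A"
    by (rule S_proportional_of_extremal[of k m A B \<sigma>]) (use assms norms ext \<open>\<sigma> \<noteq> 0\<close> in auto)
  have swap: "S m (m - k) Y X = S m k X Y" for X Y :: "complex^'n^'n"
    using \<open>k < m\<close> by (intro S_swap) simp
  obtain b where "S (m - 1) (m - k) B A = b *\<^sub>R B"
    by (rule S_proportional_of_extremal[of "m - k" m B A \<sigma>])
      (use assms norms ext \<open>\<sigma> \<noteq> 0\<close> in \<open>auto simp: swap\<close>)
  moreover have "S (m - 1) (m - k) B A = S (m - 1) (k - 1) A B"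
    using S_swap[of "k - 1" "m - 1" B A] \<open>0 < k\<close> \<open>k < m\<close> by simp
  ultimately have b: "S (m - 1) (k - 1) A B = b *\<^sub>R B" by simp
  show ?thesis
    using mult_eq_trace_scale_square[OF _ _ a] mult_eq_trace_scale_square[OF _ _ b] assms by simp
qed

end
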